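(* If $G$ is a graph on $n$ vertices having at least $\log_2(n)-1$ universal vertices, then $D(G,x)$ is unimodal with a mode at $\lceil n/2\rceil$ or $\lceil n/2\rceil+1$.
   Context: $G$ is a finite simple graph. A vertex is universal if it is adjacent to every other vertex. A set $U\subseteq V(G)$ is dominating if every vertex is in $U$ or adjacent to a vertex of $U$; $d_i(G)$ is the number of dominating sets of size $i$ and $D(G,x)=\sum_{i=1}^n d_i(G)x^i$. A polynomial is unimodal if its coefficients (ordered by increasing power of $x$) are non-decreasing and then non-increasing; it has a mode at $k$ if the coefficient of $x^k$ is the maximum coefficient. *)

theory Defs
  imports
    Complex_Main
    "HOL-Computational_Algebra.Polynomial"
    "Graph_Theory.Digraph"
begin

(* A finite simple graph is an instance of the Graph_Theory locale "graph": a finite symmetric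
   digraph without loops or parallel arcs. An undirected edge {u, v} is the pair of arcs (u, v)
   and (v, u), so dominates G u v, which says that there is an arc from u to v, is adjacency. *)

definition universal_vertex :: "('a, 'b) pre_digraph \<Rightarrow> 'a \<Rightarrow> bool" where
  "universal_vertex G v \<longleftrightarrow> v \<in> verts G \<and> (\<forall>w \<in> verts G. w \<noteq> v \<longrightarrow> dominates G v w)"

definition dominating_set :: "('a, 'b) pre_digraph \<Rightarrow> 'a set \<Rightarrow> bool" where
  "dominating_set G U \<longleftrightarrow>
     U \<subseteq> verts G \<and> (\<forall>v \<in> verts G. v \<in> U \<or> (\<exists>u \<in> U. dominates G v u))"

definition num_dominating_sets :: "('a, 'b) pre_digraph \<Rightarrow> nat \<Rightarrow> nat" where
  "num_dominating_sets G i = card {U. dominating_set G U \<and> card U = i}"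

definition domination_poly :: "('a, 'b) pre_digraph \<Rightarrow> nat poly" where
  "domination_poly G = (\<Sum>i = 1..card (verts G). monom (num_dominating_sets G i) i)"

(* The coefficient sequence of p is coeff p 0, ..., coeff p (degree p); the zeros that coeff
   returns above the degree do not belong to it. *)

definition unimodal :: "'a :: {zero, linorder} poly \<Rightarrow> bool" where
  "unimodal p \<longleftrightarrow> (\<exists>k \<le> degree p.
     (\<forall>i j. i \<le> j \<and> j \<le> k \<longrightarrow> coeff p i \<le> coeff p j) \<and>
     (\<forall>i j. k \<le> i \<and> i \<le> j \<and> j \<le> degree p \<longrightarrow> coeff p j \<le> coeff p i))"

definition has_mode_at :: "'a :: {zero, linorder} poly \<Rightarrow> nat \<Rightarrow> bool" where
  "has_mode_at p k \<longleftrightarrow> k \<le> degree p \<and> (\<forall>i \<le> degree p. coeff p i \<le> coeff p k)"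

end

theory Submission
  imports Defs
begin

text \<open>
  Supersets of dominating sets are dominating, so double counting the pairs of a dominating set of
  size \<open>i\<close> inside one of size \<open>i + 1\<close> gives \<open>(n - i) d\<^sub>i \<le> (i + 1) d\<^bsub>i+1\<^esub>\<close>, whence the coefficients
  increase up to \<open>\<lceil>n/2\<rceil>\<close>. A set that is not dominating avoids all \<open>k\<close> universal vertices, so
  \<open>C(n,i) - C(n-k,i) \<le> d\<^sub>i \<le> C(n,i)\<close>. For \<open>i \<ge> n/2\<close> each universal vertex at least halves the
  error term: \<open>2\<^sup>k C(n-k,i) \<le> C(n,i)\<close>. Since \<open>2\<^sup>k \<ge> n/2\<close>, the error is
  smaller than the drop from \<open>C(n,i)\<close> to \<open>C(n,i+1)\<close> as soon as \<open>i > \<lceil>n/2\<rceil>\<close>.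
\<close>

lemma upward_closed_level_le:
  fixes F :: "'a set set"
  assumes fin: "finite V" and sub: "\<And>U. U \<in> F \<Longrightarrow> U \<subseteq> V"
    and up: "\<And>U v. U \<in> F \<Longrightarrow> v \<in> V \<Longrightarrow> insert v U \<in> F"
  shows "(card V - i) * card {U \<in> F. card U = i} \<le> Suc i * card {U \<in> F. card U = Suc i}"
proof -
  let ?L = "\<lambda>j. {U \<in> F. card U = j}"
  \<comment> \<open>\<open>?A\<close> pairs a set of size \<open>i\<close> with an element that can
    be added, \<open>?B\<close> a set of size \<open>Suc i\<close> with an element that can be
    removed. Adding the element and remembering it embeds \<open>?A\<close> into
    \<open>?B\<close>.\<close>
  let ?A = "SIGMA U:?L i. V - U" and ?B = "SIGMA W:?L (Suc i). W"
  have finF: "finite F"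
    using fin sub by (meson PowI finite_Pow_iff finite_subset subsetI)
  have finU: "finite U" if "U \<in> F" for U
    using that sub fin finite_subset by blast
  have "card ?A = (\<Sum>U\<in>?L i. card V - i)"
    using finF fin sub finU by (simp add: card_Diff_subset)
  moreover have "card ?B = (\<Sum>W\<in>?L (Suc i). Suc i)"
    using finF finU by simp
  moreover have "card ?A \<le> card ?B"
  proof (rule card_inj_on_le)
    show "inj_on (\<lambda>(U, v). (insert v U, v)) ?A"
      by (auto simp: inj_on_def dest: insert_ident[THEN iffD1, rotated 2])
    show "(\<lambda>(U, v). (insert v U, v)) ` ?A \<subseteq> ?B"
      using up finU by auto
    show "finite ?B"
      using finF finU by auto
  qed
  ultimately show ?thesis
    by (simp add: mult.commute)
qed

text \<open>Each increment of the upper index at least doubles the binomial coefficient: in Pascal's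
  rule the new summand, with lower index \<open>i - 1\<close>, is at least the old one, because
  \<open>i - 1\<close> still lies in the non-increasing half of the row.\<close>

lemma power2_mult_binomial_le:
  assumes "m + k \<le> 2 * i"
  shows "2 ^ k * (m choose i) \<le> (m + k choose i)"
  using assms
proof (induction k)
  case (Suc k)
  have "2 * (m + k choose i) \<le> (Suc (m + k) choose i)"
  proof (cases "i \<le> m + k")
    case True
    then obtain j where j: "i = Suc j"
      using Suc.prems by (cases i) auto
    have "(m + k choose i) \<le> (m + k choose j)"
      using True Suc.prems j by (intro binomial_antimono) auto
    then show ?thesis
      by (simp add: j)
  qed (simp add: binomial_eq_0)
  with Suc show ?case
    by simp
qed simp

lemma binomial_drop_ge:
  assumes "k \<le> n" "n \<le> 2 * 2 ^ k" "n + 1 \<le> 2 * i" "i < n"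
  shows "(n choose Suc i) + (n - k choose i) \<le> (n choose i)"
proof -
  have "Suc i * (n choose Suc i) = (n - i) * (n choose i)"
    using binomial_absorb_comp[of n i] binomial_absorption[of i n] by simp
  moreover have "Suc i * (n - k choose i) \<le> 2 * (n choose i)"
  proof -
    \<comment> \<open>Here \<open>i < n\<close> gives
      \<open>Suc i \<le> n \<le> 2 * 2 ^ k\<close>.\<close>
    have "Suc i * (n - k choose i) \<le> (2 * 2 ^ k) * (n - k choose i)"
      using assms by (intro mult_right_mono) auto
    also have "\<dots> \<le> 2 * (n choose i)"
      using power2_mult_binomial_le[of "n - k" k i] assms by simp
    finally show ?thesis .
  qed
  ultimately have "Suc i * ((n choose Suc i) + (n - k choose i)) \<le> (n - i + 2) * (n choose i)"
    unfolding add_mult_distrib add_mult_distrib2 by linarith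
  \<comment> \<open>The inequality \<open>n - i + 2 \<le> Suc i\<close> amounts to
    \<open>n + 1 \<le> 2 * i\<close>.\<close>
  also have "\<dots> \<le> Suc i * (n choose i)"
    using assms by (intro mult_right_mono) auto
  finally show ?thesis
    by (simp only: Suc_mult_le_cancel1)
qed

lemma unimodal_mode_at:
  fixes p :: "'a :: {zero, linorder} poly"
  assumes "k \<le> degree p"
    and inc: "\<And>i. i < k \<Longrightarrow> coeff p i \<le> coeff p (Suc i)"
    and dec: "\<And>i. k \<le> i \<Longrightarrow> i < degree p \<Longrightarrow> coeff p (Suc i) \<le> coeff p i"
  shows "unimodal p \<and> has_mode_at p k"
proof -
  have up: "coeff p i \<le> coeff p j" if "i \<le> j" "j \<le> k" for i j
    using that by (induction j rule: dec_induct) (simp, metis Suc_le_eq inc less_imp_le order_trans)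
  have down: "coeff p j \<le> coeff p i" if "i \<le> j" "k \<le> i" "j \<le> degree p" for i j
    using that by (induction j rule: dec_induct) (simp, metis Suc_le_eq dec less_imp_le order_trans)
  show ?thesis
    unfolding unimodal_def has_mode_at_def
  proof (intro conjI exI[of _ k] allI impI)
    show "coeff p i \<le> coeff p k" if "i \<le> degree p" for i
      using up[of i k] down[of k i] that by (cases "i \<le> k") auto
  qed (use assms(1) up down in auto)
qed

text \<open>Nothing is assumed about the step from \<open>h\<close> to \<open>Suc h\<close>; its
  direction decides which of the two is the mode.\<close>

lemma unimodal_mode_at_or_Suc:
  fixes p :: "nat poly"
  assumes "h \<le> degree p"
    and inc: "\<And>i. i < h \<Longrightarrow> coeff p i \<le> coeff p (Suc i)"
    and dec: "\<And>i. h < i \<Longrightarrow> i < degree p \<Longrightarrow> coeff p (Suc i) \<le> coeff p i"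
  shows "unimodal p \<and> (has_mode_at p h \<or> has_mode_at p (Suc h))"
proof (cases "coeff p (Suc h) \<le> coeff p h")
  case True
  then show ?thesis
    using unimodal_mode_at[of h p] assms by (auto simp: le_less)
next
  case False
  \<comment> \<open>A natural number strictly above another is nonzero, so this coefficient cannot
    lie beyond the degree.\<close>
  then have "Suc h \<le> degree p"
    by (intro le_degree) auto
  moreover have "coeff p i \<le> coeff p (Suc i)" if "i < Suc h" for i
    using that inc[of i] False by (cases "i = h") auto
  ultimately show ?thesis
    using unimodal_mode_at[of "Suc h" p] dec by auto
qed

lemma num_dominating_sets_gt_card:
  assumes "finite (verts G)" "card (verts G) < i"
  shows "num_dominating_sets G i = 0"
proof -
  have "{U. dominating_set G U \<and> card U = i} = {}"
    using assms by (auto simp: dominating_set_def dest: card_mono)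
  then show ?thesis
    by (simp only: num_dominating_sets_def card.empty)
qed

lemma coeff_domination_poly:
  assumes "finite (verts G)" "verts G \<noteq> {}"
  shows "coeff (domination_poly G) i = num_dominating_sets G i"
proof -
  \<comment> \<open>The sum defining the polynomial starts at 1, so index 0 needs its own argument:
    the empty set does not dominate a nonempty graph.\<close>
  have "{U. dominating_set G U \<and> card U = 0} = {}"
    using assms by (auto simp: dominating_set_def dest: finite_subset)
  then have "num_dominating_sets G 0 = 0"
    by (simp only: num_dominating_sets_def card.empty)
  then show ?thesis
    using num_dominating_sets_gt_card[OF assms(1), of i]
    by (cases "i = 0") (auto simp: domination_poly_def coeff_sum not_le)
qed

lemma degree_domination_poly:
  assumes "finite (verts G)" "verts G \<noteq> {}"
  shows "degree (domination_poly G) = card (verts G)"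
proof (rule antisym)
  show "degree (domination_poly G) \<le> card (verts G)"
    using assms by (intro degree_le) (simp add: coeff_domination_poly num_dominating_sets_gt_card)
  \<comment> \<open>The leading coefficient is therefore 1.\<close>
  have "{U. dominating_set G U \<and> card U = card (verts G)} = {verts G}"
    using assms by (auto simp: dominating_set_def dest: card_subset_eq)
  then show "card (verts G) \<le> degree (domination_poly G)"
    using assms by (intro le_degree) (simp add: coeff_domination_poly num_dominating_sets_def)
qed

lemma num_dominating_sets_Suc_ge:
  assumes "finite (verts G)" "2 * i < card (verts G)"
  shows "num_dominating_sets G i \<le> num_dominating_sets G (Suc i)"
proof -
  \<comment> \<open>From \<open>2 * i < card (verts G)\<close> the factor
    \<open>card (verts G) - i\<close> is at least \<open>Suc i\<close>.\<close>
  have "Suc i * num_dominating_sets G i \<le> (card (verts G) - i) * num_dominating_sets G i"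
    using assms by (intro mult_right_mono) auto
  also have "\<dots> \<le> Suc i * num_dominating_sets G (Suc i)"
    using upward_closed_level_le[OF assms(1), of "Collect (dominating_set G)" i]
    by (auto simp: num_dominating_sets_def dominating_set_def)
  finally show ?thesis
    by (simp only: Suc_mult_le_cancel1)
qed

lemma num_dominating_sets_le_binomial:
  assumes "finite (verts G)"
  shows "num_dominating_sets G i \<le> (card (verts G) choose i)"
  unfolding num_dominating_sets_def n_subsets[OF assms, symmetric]
  using assms by (intro card_mono) (auto simp: dominating_set_def)

lemma dominating_set_if_universal_vertex:
  assumes "graph G" "U \<subseteq> verts G" "u \<in> U" "universal_vertex G u"
  shows "dominating_set G U"
proof -
  interpret graph G by fact
  show ?thesis
    unfolding dominating_set_def
  proof (intro conjI ballI)
    fix v assume "v \<in> verts G"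
    then show "v \<in> U \<or> (\<exists>u \<in> U. dominates G v u)"
    proof (cases "v = u")
      case False
      then have "dominates G u v"
        using assms(4) \<open>v \<in> verts G\<close> by (simp add: universal_vertex_def)
      \<comment> \<open>Universality supplies the arc leaving \<open>u\<close>, whereas domination
        asks for the arc from \<open>v\<close> into the set.\<close>
      then have "dominates G v u"
        by (rule arcs_ends_symmetric[OF sym_arcs])
      then show ?thesis
        using assms(3) by (intro disjI2 bexI)
    qed (simp add: assms(3))
  qed fact
qed

lemma binomial_le_num_dominating_sets:
  assumes "graph G"
  shows "(card (verts G) choose i) \<le>
    num_dominating_sets G i + (card (verts G) - card {v. universal_vertex G v} choose i)"
proof -
  interpret graph G by fact
  let ?K = "{v. universal_vertex G v}"
  have K: "?K \<subseteq> verts G"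
    by (auto simp: universal_vertex_def)
  have "{U. U \<subseteq> verts G \<and> card U = i} \<subseteq>
      {U. dominating_set G U \<and> card U = i} \<union> {U. U \<subseteq> verts G - ?K \<and> card U = i}"
    using dominating_set_if_universal_vertex[OF assms] by blast
  then have "card {U. U \<subseteq> verts G \<and> card U = i} \<le>
      card ({U. dominating_set G U \<and> card U = i} \<union> {U. U \<subseteq> verts G - ?K \<and> card U = i})"
    by (intro card_mono) (auto simp: dominating_set_def)
  also have "\<dots> \<le> num_dominating_sets G i + card {U. U \<subseteq> verts G - ?K \<and> card U = i}"
    unfolding num_dominating_sets_def by (rule card_Un_le)
  finally show ?thesis
    using K by (simp add: n_subsets card_Diff_subset finite_subset[OF K])
qed

theorem theorem7p4:
  fixes G :: "('a, 'b) pre_digraph" and n :: nat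
  assumes "graph G"
    and "card (verts G) = n"
    and "real (card {v. universal_vertex G v}) \<ge> log 2 (real n) - 1"
  shows "unimodal (domination_poly G) \<and>
    (has_mode_at (domination_poly G) (nat \<lceil>real n / 2\<rceil>) \<or>
     has_mode_at (domination_poly G) (nat \<lceil>real n / 2\<rceil> + 1))"
\<comment> \<open>The coefficient and degree lemmas need a vertex; the empty graph has the zero
  polynomial, with mode at 0.\<close>
proof (cases "n = 0")
  case True
  then have "domination_poly G = 0"
    using assms(2) by (simp add: domination_poly_def)
  then show ?thesis
    using True by (simp add: unimodal_def has_mode_at_def)
next
  case False
  interpret graph G by fact
  let ?k = "card {v. universal_vertex G v}" and ?p = "domination_poly G"
  define h where "h = nat \<lceil>real n / 2\<rceil>"
  \<comment> \<open>In this form \<open>i < h\<close> yields \<open>2 * i < n\<close>, and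
    \<open>h < i\<close> yields \<open>n + 1 \<le> 2 * i\<close>.\<close>
  have h: "h = (n + 1) div 2"
    unfolding h_def by linarith
  have V: "finite (verts G)" "verts G \<noteq> {}"
    using False assms(2) by auto
  have kn: "?k \<le> n"
    unfolding assms(2)[symmetric] by (intro card_mono) (auto simp: universal_vertex_def)
  have "real n \<le> 2 powr (real ?k + 1)"
    using assms(3) False by (subst log_le_iff[symmetric]) auto
  also have "\<dots> = real (2 * 2 ^ ?k)"
    by (simp add: powr_add powr_realpow)
  finally have nk: "n \<le> 2 * 2 ^ ?k"
    by (simp only: of_nat_le_iff)
  have "unimodal ?p \<and> (has_mode_at ?p h \<or> has_mode_at ?p (Suc h))"
  proof (rule unimodal_mode_at_or_Suc)
    show "h \<le> degree ?p"
      using False by (simp add: degree_domination_poly V assms(2) h)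
    show "coeff ?p i \<le> coeff ?p (Suc i)" if "i < h" for i
      unfolding coeff_domination_poly[OF V]
      using that V(1) by (intro num_dominating_sets_Suc_ge) (auto simp: assms(2) h)
    show "coeff ?p (Suc i) \<le> coeff ?p i" if "h < i" "i < degree ?p" for i
    proof -
      have "(n choose Suc i) + (n - ?k choose i) \<le> (n choose i)"
        using that by (intro binomial_drop_ge kn nk) (auto simp: h degree_domination_poly V assms(2))
      then show ?thesis
        using num_dominating_sets_le_binomial[OF V(1), of "Suc i"]
          binomial_le_num_dominating_sets[OF assms(1), of i]
        unfolding coeff_domination_poly[OF V] assms(2) by linarith
    qed
  qed
  then show ?thesis
    by (simp add: h_def)
qed

end
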